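(* Every dual-feasible pair $(\hat\lambda,\hat\mu)$ returned by the certification layer defines a valid Benders optimality cut: with $$\alpha:=b^\top\hat\lambda+g^\top\hat\mu,\qquad \beta:=-A^\top\hat\lambda,$$ the inequality $\theta\ge\alpha+\beta^\top y$ is valid, i.e. $Q(y)\ge\alpha+\beta^\top y$ for every $y$ for which the recourse linear program defining $Q(y)$ is feasible and bounded.
   Context: Data: real matrices $A,B,G$ and real vectors $b,g,q$ of compatible dimensions; $d(y):=b-Ay$. The recourse linear program is $Q(y):=\min_{x\ge 0}\{q^\top x:\ Bx\ge d(y),\ Gx\ge g\}$, with dual $\max\{d(y)^\top\lambda+g^\top\mu:\ B^\top\lambda+G^\top\mu\le q,\ \lambda\ge 0,\ \mu\ge 0\}$; a pair $(\lambda,\mu)$ is dual-feasible if $B^\top\lambda+G^\top\mu\le q$, $\lambda\ge 0$, $\mu\ge 0$. The certification layer takes an arbitrary real vector $\tilde\lambda$ (a neural network output), sets $\hat\lambda:=(\tilde\lambda)_+$ (componentwise positive part), and returns $(\hat\lambda,\hat\mu)$ with $\hat\mu\in\arg\max_{\mu\ge 0}\{g^\top\mu:\ G^\top\mu\le q-B^\top\hat\lambda\}$. All vector inequalities are componentwise. *)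

theory Defs
  imports "HOL-Analysis.Analysis"
begin

text \<open>
  Vector inequalities are the componentwise order on \<^typ>\<open>real ^ 'n\<close>.
  In the recourse program, \<open>A\<close> and \<open>B\<close> have rows indexed by \<open>'m\<close>, \<open>G\<close> has rows
  indexed by \<open>'p\<close>, the first-stage vector \<open>y\<close> is indexed by \<open>'k\<close>, and the recourse
  vector \<open>x\<close> by \<open>'n\<close>.
\<close>

definition rhs :: "real ^ 'k ^ 'm \<Rightarrow> real ^ 'm \<Rightarrow> real ^ 'k \<Rightarrow> real ^ 'm" where
  "rhs A b y = b - A *v y"

definition recourse_feasible_set ::
  "real ^ 'k ^ 'm \<Rightarrow> real ^ 'n ^ 'm \<Rightarrow> real ^ 'n ^ 'p \<Rightarrow> real ^ 'm \<Rightarrow> real ^ 'p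
    \<Rightarrow> real ^ 'k \<Rightarrow> (real ^ 'n) set" where
  "recourse_feasible_set A B G b g y = {x. 0 \<le> x \<and> rhs A b y \<le> B *v x \<and> g \<le> G *v x}"

definition recourse_values ::
  "real ^ 'k ^ 'm \<Rightarrow> real ^ 'n ^ 'm \<Rightarrow> real ^ 'n ^ 'p \<Rightarrow> real ^ 'm \<Rightarrow> real ^ 'p \<Rightarrow> real ^ 'n
    \<Rightarrow> real ^ 'k \<Rightarrow> real set" where
  "recourse_values A B G b g q y = (\<lambda>x. q \<bullet> x) ` recourse_feasible_set A B G b g y"

definition recourse_feasible ::
  "real ^ 'k ^ 'm \<Rightarrow> real ^ 'n ^ 'm \<Rightarrow> real ^ 'n ^ 'p \<Rightarrow> real ^ 'm \<Rightarrow> real ^ 'p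
    \<Rightarrow> real ^ 'k \<Rightarrow> bool" where
  "recourse_feasible A B G b g y \<longleftrightarrow> recourse_feasible_set A B G b g y \<noteq> {}"

text \<open>
  As usual for a minimisation problem, boundedness of the program refers to its objective
  and not to its feasible set.
\<close>

definition recourse_bounded ::
  "real ^ 'k ^ 'm \<Rightarrow> real ^ 'n ^ 'm \<Rightarrow> real ^ 'n ^ 'p \<Rightarrow> real ^ 'm \<Rightarrow> real ^ 'p \<Rightarrow> real ^ 'n
    \<Rightarrow> real ^ 'k \<Rightarrow> bool" where
  "recourse_bounded A B G b g q y \<longleftrightarrow> bdd_below (recourse_values A B G b g q y)"

text \<open>
  The minimum is the least element of the set of objective values (\<^const>\<open>Min\<close> is only for
  finite sets). It is meaningful only where the minimum is attained, which for a linear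
  program is the case exactly when it is feasible and bounded.
\<close>

definition recourse_Q ::
  "real ^ 'k ^ 'm \<Rightarrow> real ^ 'n ^ 'm \<Rightarrow> real ^ 'n ^ 'p \<Rightarrow> real ^ 'm \<Rightarrow> real ^ 'p \<Rightarrow> real ^ 'n
    \<Rightarrow> real ^ 'k \<Rightarrow> real" where
  "recourse_Q A B G b g q y = (LEAST v. v \<in> recourse_values A B G b g q y)"

definition dual_feasible ::
  "real ^ 'n ^ 'm \<Rightarrow> real ^ 'n ^ 'p \<Rightarrow> real ^ 'n \<Rightarrow> real ^ 'm \<Rightarrow> real ^ 'p \<Rightarrow> bool" where
  "dual_feasible B G q l u \<longleftrightarrow>
     transpose B *v l + transpose G *v u \<le> q \<and> 0 \<le> l \<and> 0 \<le> u"

definition pos_part :: "real ^ 'm \<Rightarrow> real ^ 'm" where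
  "pos_part v = (\<chi> i. max (v $ i) 0)"

text \<open>
  The layer is set-valued, since the maximiser \<open>u\<close> need not be unique (and need not exist,
  in which case the layer returns nothing).
\<close>

definition certification_layer ::
  "real ^ 'n ^ 'm \<Rightarrow> real ^ 'n ^ 'p \<Rightarrow> real ^ 'p \<Rightarrow> real ^ 'n \<Rightarrow> real ^ 'm
    \<Rightarrow> ((real ^ 'm) \<times> (real ^ 'p)) set" where
  "certification_layer B G g q lt =
     {(l, u). l = pos_part lt \<and>
        is_arg_max (\<lambda>u. g \<bullet> u) (\<lambda>u. 0 \<le> u \<and> transpose G *v u \<le> q - transpose B *v l) u}"

definition valid_optimality_cut ::
  "real ^ 'k ^ 'm \<Rightarrow> real ^ 'n ^ 'm \<Rightarrow> real ^ 'n ^ 'p \<Rightarrow> real ^ 'm \<Rightarrow> real ^ 'p \<Rightarrow> real ^ 'n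
    \<Rightarrow> real \<Rightarrow> real ^ 'k \<Rightarrow> bool" where
  "valid_optimality_cut A B G b g q \<alpha> \<beta> \<longleftrightarrow>
     (\<forall>y. recourse_feasible A B G b g y \<and> recourse_bounded A B G b g q y \<longrightarrow>
        recourse_Q A B G b g q y \<ge> \<alpha> + \<beta> \<bullet> y)"

end

theory Submission
  imports Defs
begin

text \<open>
  The cut is weak duality. Since \<open>(lh, mh)\<close> is dual feasible, its dual objective
  \<open>rhs A b y \<bullet> lh + g \<bullet> mh\<close> bounds \<open>q \<bullet> x\<close> from below for every recourse-feasible \<open>x\<close>
  (lemma \<open>weak_duality\<close>). The feasible region of the dual does not involve \<open>y\<close>, so one pair
  serves all \<open>y\<close> at once, and as a function of \<open>y\<close> the bound is affine with intercept \<open>\<alpha>\<close>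
  and slope \<open>\<beta>\<close>.

  It remains to pass from all values \<open>q \<bullet> x\<close> to their minimum \<open>Q(y)\<close>. Here it matters that a
  linear program which is feasible and bounded attains its optimum
  (\<open>linear_attains_min_on_polyhedron\<close>): without attainment the least value would be
  unspecified and no bound on the values would carry over to it. Compactness is not available, as
  the feasible region may be unbounded; the argument uses active sets instead. From
  any point one can move, without increasing the objective and by making further constraints
  active, to a point at which the objective is constant along the affine set cut out by the
  active constraints. The value at such a point depends on the active set alone, so
  finitely many attained values bound all the others from below.
\<close>

text \<open>
  If the objective \<open>c\<close> varies along the directions that keep all active constraints tight, one of
  these directions is a descent direction. By boundedness the ray in this direction
  leaves the polyhedron, and where it does, a constraint becomes active in
  addition to all the earlier ones. As there are finitely many constraints, iterating this
  ends.
\<close>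

lemma descend_to_objective_constant_on_active_face:
  fixes a :: "'i \<Rightarrow> 'a::real_inner" and b :: "'i \<Rightarrow> real"
  assumes fin: "finite I"
    and bdd: "\<And>z. (\<And>i. i \<in> I \<Longrightarrow> a i \<bullet> z \<le> b i) \<Longrightarrow> L \<le> c \<bullet> z"
    and x: "\<And>i. i \<in> I \<Longrightarrow> a i \<bullet> x \<le> b i"
  shows "\<exists>z. (\<forall>i\<in>I. a i \<bullet> z \<le> b i) \<and> c \<bullet> z \<le> c \<bullet> x \<and>
           (\<forall>d. (\<forall>i\<in>I. a i \<bullet> z = b i \<longrightarrow> a i \<bullet> d = 0) \<longrightarrow> c \<bullet> d = 0)"
  using x
proof (induction "card {i\<in>I. a i \<bullet> x < b i}" arbitrary: x rule: less_induct)
  case less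
  note x = less.prems
  show ?case
  proof (cases "\<forall>d. (\<forall>i\<in>I. a i \<bullet> x = b i \<longrightarrow> a i \<bullet> d = 0) \<longrightarrow> c \<bullet> d = 0")
    case True
    with x show ?thesis by blast
  next
    case False
    then obtain d0 where d0: "\<And>i. i \<in> I \<Longrightarrow> a i \<bullet> x = b i \<Longrightarrow> a i \<bullet> d0 = 0" "c \<bullet> d0 \<noteq> 0"
      by blast
    define d where "d = (if c \<bullet> d0 < 0 then d0 else - d0)"
    have d: "\<And>i. i \<in> I \<Longrightarrow> a i \<bullet> x = b i \<Longrightarrow> a i \<bullet> d = 0" and cd: "c \<bullet> d < 0"
      using d0 by (auto simp: d_def)
    define K where "K = {i\<in>I. a i \<bullet> d > 0}"
    have "finite K" using fin by (simp add: K_def)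
    have "K \<noteq> {}"
    proof
      assume "K = {}"
      then have le0: "a i \<bullet> d \<le> 0" if "i \<in> I" for i
        using that by (auto simp: K_def not_less)
      define t where "t = (c \<bullet> x - L + 1) / - (c \<bullet> d)"
      have "L \<le> c \<bullet> x" using bdd x by blast
      then have "t \<ge> 0" using cd unfolding t_def by (intro divide_nonneg_pos) auto
      then have "a i \<bullet> (x + t *\<^sub>R d) \<le> b i" if "i \<in> I" for i
        using x[OF that] mult_nonneg_nonpos[OF _ le0[OF that], of t] by (simp add: inner_add_right)
      then have "L \<le> c \<bullet> (x + t *\<^sub>R d)" using bdd by blast
      also have "\<dots> = L - 1"
        using cd by (simp add: t_def inner_add_right inner_diff_right)
      finally show False by simp
    qed
    define r where "r i = (b i - a i \<bullet> x) / (a i \<bullet> d)" for i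
    define t where "t = Min (r ` K)"
    have "t \<in> r ` K"
      unfolding t_def using \<open>finite K\<close> \<open>K \<noteq> {}\<close> by (intro Min_in) auto
    then obtain i0 where i0: "i0 \<in> K" "t = r i0" by blast
    have t_le: "t \<le> r i" if "i \<in> K" for i
      using that \<open>finite K\<close> by (simp add: t_def)
    have "t \<ge> 0"
      using i0 x[of i0] by (auto simp: r_def K_def)
    define y where "y = x + t *\<^sub>R d"
    have y: "a i \<bullet> y \<le> b i" if "i \<in> I" for i
    proof (cases "i \<in> K")
      case True
      then have "t * (a i \<bullet> d) \<le> b i - a i \<bullet> x"
        using t_le[OF True] by (simp add: r_def K_def pos_le_divide_eq)
      then show ?thesis by (simp add: y_def inner_add_right)
    next
      case False
      then have "t * (a i \<bullet> d) \<le> 0"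
        using that \<open>t \<ge> 0\<close> by (simp add: K_def mult_nonneg_nonpos)
      then show ?thesis using x[OF that] by (simp add: y_def inner_add_right)
    qed
    have i0_tight: "a i0 \<bullet> y = b i0"
      using i0 by (simp add: y_def inner_add_right r_def K_def)
    have i0_slack: "i0 \<in> I" "a i0 \<bullet> x < b i0"
      using i0 x[of i0] d[of i0] by (force simp: K_def)+
    have "{i\<in>I. a i \<bullet> y < b i} \<subset> {i\<in>I. a i \<bullet> x < b i}"
    proof
      show "{i\<in>I. a i \<bullet> y < b i} \<subseteq> {i\<in>I. a i \<bullet> x < b i}"
        using x d by (force simp: y_def inner_add_right order.order_iff_strict)
      show "{i\<in>I. a i \<bullet> y < b i} \<noteq> {i\<in>I. a i \<bullet> x < b i}"
        using i0_tight i0_slack by force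
    qed
    then have "card {i\<in>I. a i \<bullet> y < b i} < card {i\<in>I. a i \<bullet> x < b i}"
      using fin by (intro psubset_card_mono) auto
    from less.hyps[OF this y] obtain z where z: "\<forall>i\<in>I. a i \<bullet> z \<le> b i" "c \<bullet> z \<le> c \<bullet> y"
      "\<forall>d. (\<forall>i\<in>I. a i \<bullet> z = b i \<longrightarrow> a i \<bullet> d = 0) \<longrightarrow> c \<bullet> d = 0"
      by blast
    moreover have "c \<bullet> y \<le> c \<bullet> x"
      using \<open>t \<ge> 0\<close> cd by (simp add: y_def inner_add_right mult_nonneg_nonpos)
    ultimately show ?thesis by (meson order_trans)
  qed
qed

text \<open>
  Two points to which the preceding lemma descends and which have the same active set differ by a
  direction that keeps this set tight, hence have the same objective value. So these
  points realise at most one value for each subset of the constraints, and the smallest of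
  these finitely many values is the minimum.
\<close>

lemma linear_attains_min_on_polyhedron:
  fixes S :: "'a::euclidean_space set"
  assumes "polyhedron S" "S \<noteq> {}" and bdd: "bdd_below ((\<lambda>x. c \<bullet> x) ` S)"
  shows "\<exists>x\<in>S. \<forall>y\<in>S. c \<bullet> x \<le> c \<bullet> y"
proof -
  obtain F where F: "finite F" "S = \<Inter>F" "\<forall>h\<in>F. \<exists>a b. a \<noteq> 0 \<and> h = {x. a \<bullet> x \<le> b}"
    using \<open>polyhedron S\<close> unfolding polyhedron_def by auto
  then obtain a b where "\<And>h. h \<in> F \<Longrightarrow> h = {x. a h \<bullet> x \<le> b h}"
    by metis
  then have S: "x \<in> S \<longleftrightarrow> (\<forall>h\<in>F. a h \<bullet> x \<le> b h)" for x
    using F(2) by blast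
  obtain L where L: "\<And>x. x \<in> S \<Longrightarrow> L \<le> c \<bullet> x"
    using bdd by (auto simp: bdd_below_def)
  define J where "J x = {h\<in>F. a h \<bullet> x = b h}" for x
  define V where "V = {x\<in>S. \<forall>d. (\<forall>h\<in>J x. a h \<bullet> d = 0) \<longrightarrow> c \<bullet> d = 0}"
  have descend: "\<exists>z\<in>V. c \<bullet> z \<le> c \<bullet> x" if "x \<in> S" for x
    using descend_to_objective_constant_on_active_face[of F a b L c x] that L F(1)
    by (auto simp: V_def J_def S)
  have same_value: "c \<bullet> x = c \<bullet> y" if "x \<in> V" "y \<in> V" "J x = J y" for x y
  proof -
    have "a h \<bullet> (y - x) = 0" if "h \<in> J x" for h
      using that \<open>J x = J y\<close> by (auto simp: J_def inner_diff_right)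
    then have "c \<bullet> (y - x) = 0" using \<open>x \<in> V\<close> by (auto simp: V_def)
    then show ?thesis by (simp add: inner_diff_right)
  qed
  have "finite ((\<lambda>x. c \<bullet> x) ` V)"
  proof (rule finite_subset)
    show "(\<lambda>x. c \<bullet> x) ` V \<subseteq> (\<lambda>M. c \<bullet> (SOME v. v \<in> V \<and> J v = M)) ` Pow F"
    proof (rule image_subsetI)
      fix x assume "x \<in> V"
      then have "(SOME v. v \<in> V \<and> J v = J x) \<in> V \<and> J (SOME v. v \<in> V \<and> J v = J x) = J x"
        by (intro someI[of "\<lambda>v. v \<in> V \<and> J v = J x" x]) simp
      then have "c \<bullet> x = c \<bullet> (SOME v. v \<in> V \<and> J v = J x)"
        using same_value \<open>x \<in> V\<close> by metis
      moreover have "J x \<in> Pow F" by (auto simp: J_def)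
      ultimately show "c \<bullet> x \<in> (\<lambda>M. c \<bullet> (SOME v. v \<in> V \<and> J v = M)) ` Pow F"
        by blast
    qed
  qed (use F(1) in simp)
  moreover have "V \<noteq> {}" using descend \<open>S \<noteq> {}\<close> by blast
  ultimately obtain x where x: "x \<in> V" "\<And>z. z \<in> V \<Longrightarrow> c \<bullet> x \<le> c \<bullet> z"
    using Min_in[of "(\<lambda>x. c \<bullet> x) ` V"] Min_le[of "(\<lambda>x. c \<bullet> x) ` V"]
    by (smt (verit, ccfv_SIG) empty_is_image imageE imageI)
  moreover have "x \<in> S" using x(1) by (simp add: V_def)
  ultimately show ?thesis using descend by (meson order_trans)
qed

lemma polyhedron_matrix_ge:
  fixes M :: "real ^ 'n ^ 'm"
  shows "polyhedron {x. v \<le> M *v x}"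
proof -
  have "{x. v \<le> M *v x} = \<Inter> (range (\<lambda>i. {x. row i M \<bullet> x \<ge> v $ i}))"
    by (auto simp: less_eq_vec_def matrix_vector_mul_component row_def)
  also have "polyhedron \<dots>"
    by (intro polyhedron_Inter) (auto intro: polyhedron_halfspace_ge)
  finally show ?thesis .
qed

lemma polyhedron_recourse_feasible_set:
  "polyhedron (recourse_feasible_set A B G b g y)"
proof -
  have "recourse_feasible_set A B G b g y =
      {x. 0 \<le> mat 1 *v x} \<inter> {x. rhs A b y \<le> B *v x} \<inter> {x. g \<le> G *v x}"
    by (auto simp: recourse_feasible_set_def)
  then show ?thesis by (simp only: polyhedron_Int polyhedron_matrix_ge)
qed

lemma recourse_Q_attained:
  assumes "recourse_feasible A B G b g y" "recourse_bounded A B G b g q y"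
  shows "\<exists>x\<in>recourse_feasible_set A B G b g y. recourse_Q A B G b g q y = q \<bullet> x"
proof -
  obtain x where x: "x \<in> recourse_feasible_set A B G b g y"
    "\<forall>z\<in>recourse_feasible_set A B G b g y. q \<bullet> x \<le> q \<bullet> z"
    using linear_attains_min_on_polyhedron[OF polyhedron_recourse_feasible_set] assms
    unfolding recourse_feasible_def recourse_bounded_def recourse_values_def by blast
  then have "recourse_Q A B G b g q y = q \<bullet> x"
    unfolding recourse_Q_def recourse_values_def by (intro Least_equality) auto
  with x(1) show ?thesis by blast
qed

lemma inner_vec_left_mono:
  fixes u v w :: "real ^ 'n"
  assumes "0 \<le> u" "v \<le> w"
  shows "u \<bullet> v \<le> u \<bullet> w"
  using assms by (auto simp: inner_vec_def less_eq_vec_def intro!: sum_mono mult_left_mono)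

lemma weak_duality:
  assumes dual: "dual_feasible B G q l u" and primal: "x \<in> recourse_feasible_set A B G b g y"
  shows "rhs A b y \<bullet> l + g \<bullet> u \<le> q \<bullet> x"
proof -
  have "rhs A b y \<bullet> l + g \<bullet> u \<le> l \<bullet> (B *v x) + u \<bullet> (G *v x)"
    using dual primal
    by (auto simp: dual_feasible_def recourse_feasible_set_def inner_commute[of _ l]
        inner_commute[of _ u] intro!: add_mono inner_vec_left_mono)
  also have "\<dots> = x \<bullet> (transpose B *v l + transpose G *v u)"
    by (simp add: dot_lmul_matrix[symmetric] inner_add_right inner_commute[of x])
  also have "\<dots> \<le> x \<bullet> q"
    using dual primal
    by (intro inner_vec_left_mono) (auto simp: dual_feasible_def recourse_feasible_set_def)
  finally show ?thesis by (simp add: inner_commute)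
qed

theorem proposition3:
  fixes A :: "real ^ 'k ^ 'm" and B :: "real ^ 'n ^ 'm" and G :: "real ^ 'n ^ 'p"
    and b :: "real ^ 'm" and g :: "real ^ 'p" and q :: "real ^ 'n"
    and lt lh :: "real ^ 'm" and mh :: "real ^ 'p"
    and \<alpha> :: real and \<beta> :: "real ^ 'k"
  assumes "(lh, mh) \<in> certification_layer B G g q lt"
    and "dual_feasible B G q lh mh"
    and "\<alpha> = b \<bullet> lh + g \<bullet> mh"
    and "\<beta> = - (transpose A *v lh)"
  shows "valid_optimality_cut A B G b g q \<alpha> \<beta>"
  unfolding valid_optimality_cut_def
proof (intro allI impI, elim conjE)
  fix y
  assume "recourse_feasible A B G b g y" "recourse_bounded A B G b g q y"
  then obtain x where x: "x \<in> recourse_feasible_set A B G b g y"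
    "recourse_Q A B G b g q y = q \<bullet> x"
    using recourse_Q_attained by blast
  have "\<alpha> + \<beta> \<bullet> y = rhs A b y \<bullet> lh + g \<bullet> mh"
    using assms(3,4)
    by (simp add: rhs_def inner_diff_left dot_lmul_matrix inner_commute[of "A *v y"])
  also have "\<dots> \<le> recourse_Q A B G b g q y"
    using weak_duality[OF assms(2) x(1)] x(2) by simp
  finally show "recourse_Q A B G b g q y \<ge> \<alpha> + \<beta> \<bullet> y" .
qed

end
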